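(* Let $\sigma, \tau \in S_n$. Then $|X_\sigma| \le |X_\tau|$ holds for all positive semi-definite $X \in M_n(\mathbb{C})$ if and only if $[\tau] \leq_{[\mathrm{c}]} [\sigma]$. Moreover, $|X_\sigma| = |X_\tau|$ holds for all positive semi-definite $X \in M_n(\mathbb{C})$ if and only if $\tau \sim_{\mathrm{c}} \sigma$.
   Context: $X \in M_n(\mathbb{C})$ is positive semi-definite if $X = X^*$ and $z^* X z \ge 0$ for all $z \in \mathbb{C}^n$. For $X=(x_{ij})$ and $\sigma \in S_n$, $X_\sigma = \prod_{k=1}^n x_{k,\sigma(k)}$. For $\sigma \in S_n$ and $\ell \ge 2$, $C_\ell(\sigma)$ is the set of $\ell$-cycles of $\sigma$; $\tau \leq_{\mathrm{c}} \sigma$ iff $C_k(\tau) \subseteq C_k(\sigma)$ for all $k \ge 2$. The equivalence relation $\sim_{\mathrm{c}}$: $\sigma \sim_{\mathrm{c}} \tau$ if each cycle of $\sigma$ (fixed points included as 1-cycles) is equal to or the inverse of a cycle of $\tau$, and vice versa; $[\sigma]$ is the class of $\sigma$. $[\tau] \leq_{[\mathrm{c}]} [\sigma]$ iff there exist $\tau' \in [\tau]$, $\sigma' \in [\sigma]$ with $\tau' \leq_{\mathrm{c}} \sigma'$. *)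

theory Defs
  imports "HOL-Analysis.Analysis" "HOL-Combinatorics.Orbits"
begin

definition adjoint_matrix :: "complex^'n^'m \<Rightarrow> complex^'m^'n" where
  "adjoint_matrix X = map_matrix cnj (transpose X)"

text \<open>The sum is the complex number $z^* X z$; membership in the nonnegative reals
  says that it is real and nonnegative.\<close>

definition pos_semidef :: "complex^'n^'n \<Rightarrow> bool" where
  "pos_semidef X \<longleftrightarrow>
     X = adjoint_matrix X \<and> (\<forall>z. (\<Sum>i\<in>UNIV. cnj (z $ i) * (X *v z) $ i) \<in> \<real>\<^sub>\<ge>\<^sub>0)"

definition perm_prod :: "complex^'n^'n \<Rightarrow> ('n \<Rightarrow> 'n) \<Rightarrow> complex" where
  "perm_prod X \<sigma> = (\<Prod>k\<in>UNIV. X $ k $ \<sigma> k)"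

text \<open>The cycle $(x_1\, x_2 \dots x_\ell)$ is encoded as the set of pairs
  $\{(x_1,x_2), \dots, (x_{\ell-1},x_\ell), (x_\ell,x_1)\}$. Unlike the encoding of a cycle
  as a permutation, this keeps distinct 1-cycles $\{(x,x)\}$ apart. The inverse
  of a cycle is the converse relation.\<close>

definition cycles_of_length :: "nat \<Rightarrow> ('a \<Rightarrow> 'a) \<Rightarrow> ('a \<times> 'a) set set" where
  "cycles_of_length l \<sigma> = {{(x, \<sigma> x) | x. x \<in> S} | S. cyclic_on \<sigma> S \<and> card S = l}"

definition all_cycles :: "('a \<Rightarrow> 'a) \<Rightarrow> ('a \<times> 'a) set set" where
  "all_cycles \<sigma> = (\<Union>l\<in>{1..}. cycles_of_length l \<sigma>)"

definition cyc_le :: "('a \<Rightarrow> 'a) \<Rightarrow> ('a \<Rightarrow> 'a) \<Rightarrow> bool" where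
  "cyc_le \<tau> \<sigma> \<longleftrightarrow> (\<forall>l\<ge>2. cycles_of_length l \<tau> \<subseteq> cycles_of_length l \<sigma>)"

definition cyc_equiv :: "('a \<Rightarrow> 'a) \<Rightarrow> ('a \<Rightarrow> 'a) \<Rightarrow> bool" where
  "cyc_equiv \<sigma> \<tau> \<longleftrightarrow>
     (\<forall>c\<in>all_cycles \<sigma>. \<exists>d\<in>all_cycles \<tau>. c = d \<or> c = d\<inverse>) \<and>
     (\<forall>d\<in>all_cycles \<tau>. \<exists>c\<in>all_cycles \<sigma>. d = c \<or> d = c\<inverse>)"

definition cyc_class :: "('a \<Rightarrow> 'a) \<Rightarrow> ('a \<Rightarrow> 'a) set" where
  "cyc_class \<sigma> = {\<tau>. \<tau> permutes UNIV \<and> cyc_equiv \<sigma> \<tau>}"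

definition cyc_class_le :: "('a \<Rightarrow> 'a) set \<Rightarrow> ('a \<Rightarrow> 'a) set \<Rightarrow> bool" where
  "cyc_class_le A B \<longleftrightarrow> (\<exists>\<tau>'\<in>A. \<exists>\<sigma>'\<in>B. cyc_le \<tau>' \<sigma>')"

end

theory Submission
  imports Defs
begin

text \<open>
  Testing the inequality on two Gram matrices of planar vectors recovers the cycle structure.
  Fix \<open>a \<noteq> b\<close>, take \<open>(p, -1)\<close> at \<open>a\<close>, \<open>(p, 1)\<close> at \<open>b\<close> and \<open>(1, 0)\<close> elsewhere. For \<open>p = 1\<close> only
  the entry at \<open>{a, b}\<close> vanishes, so every edge of \<open>\<tau>\<close> is an edge of \<open>\<sigma>\<close> up to orientation. For
  \<open>p = 2\<close> a transposition \<open>(a b)\<close> of \<open>\<tau>\<close> contributes \<open>3 * 3 = 9\<close>, whereas a longer cycle of \<open>\<sigma>\<close>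
  through the edge \<open>{a, b}\<close> contributes \<open>2 * 3 * 2 = 12\<close>. Hence every nontrivial cycle of \<open>\<tau>\<close> is a
  cycle of \<open>\<sigma>\<close> or the inverse of one. Conversely, replacing a cycle by fixed points does not
  decrease the modulus, by the bound on the off-diagonal entries of a positive semidefinite matrix.
\<close>

section \<open>Cycles up to orientation\<close>

text \<open>Pointwise form of \<open>cyc_equiv\<close>: for permutations of a finite type,
  \<open>E\<close> is the union of the cycles that get inverted. It trades sets of pairs for
  equations between values.\<close>

definition reverses_on :: "'a set \<Rightarrow> ('a \<Rightarrow> 'a) \<Rightarrow> ('a \<Rightarrow> 'a) \<Rightarrow> bool" where
  "reverses_on E \<sigma> \<tau> \<longleftrightarrow> \<sigma> ` E = E \<and> (\<forall>x\<in>E. \<tau> (\<sigma> x) = x) \<and> (\<forall>x. x \<notin> E \<longrightarrow> \<tau> x = \<sigma> x)"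

lemma reverses_on_sym:
  assumes "reverses_on E \<sigma> \<tau>"
  shows "reverses_on E \<tau> \<sigma>"
proof -
  have *: "\<sigma> ` E = E" "\<And>x. x \<in> E \<Longrightarrow> \<tau> (\<sigma> x) = x" "\<And>x. x \<notin> E \<Longrightarrow> \<tau> x = \<sigma> x"
    using assms by (auto simp: reverses_on_def)
  have "\<tau> ` E = \<tau> ` \<sigma> ` E" using *(1) by simp
  also have "\<dots> = E" using *(2) by (force simp: image_iff)
  finally have "\<tau> ` E = E" .
  moreover have "\<sigma> (\<tau> x) = x" if "x \<in> E" for x
    using *(1,2) that by (metis imageE)
  ultimately show ?thesis using *(3) by (auto simp: reverses_on_def)
qed

lemma in_all_cyclesI:
  assumes "cyclic_on \<sigma> S"
  shows "{(x, \<sigma> x) | x. x \<in> S} \<in> all_cycles \<sigma>"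
proof -
  have "finite S" using assms by (rule finite_cyclic_on)
  moreover have "S \<noteq> {}" using assms by (simp add: cyclic_on_alldef)
  ultimately have "card S \<ge> 1" by (simp add: Suc_leI card_gt_0_iff)
  then show ?thesis using assms by (auto simp: all_cycles_def cycles_of_length_def)
qed

text \<open>The invariant set \<open>E\<close> contains a cycle of \<open>\<sigma>\<close> or misses
  it. If it misses it, \<open>\<tau>\<close> has the same cycle; if it contains it,
  \<open>\<tau>\<close> agrees there with \<open>inv \<sigma>\<close>, which has the same
  orbits.\<close>

lemma reverses_on_all_cycles:
  fixes \<sigma> \<tau> :: "'n::finite \<Rightarrow> 'n"
  assumes "\<sigma> permutes UNIV" "reverses_on E \<sigma> \<tau>" "c \<in> all_cycles \<sigma>"
  shows "\<exists>d\<in>all_cycles \<tau>. c = d \<or> c = d\<inverse>"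
proof -
  have E: "\<sigma> ` E = E" "\<And>x. x \<in> E \<Longrightarrow> \<tau> (\<sigma> x) = x" "\<And>x. x \<notin> E \<Longrightarrow> \<tau> x = \<sigma> x"
    using assms(2) by (auto simp: reverses_on_def)
  obtain S where S: "cyclic_on \<sigma> S" and c: "c = {(x, \<sigma> x) | x. x \<in> S}"
    using assms(3) by (auto simp: all_cycles_def cycles_of_length_def)
  have perm: "permutation \<sigma>" using assms(1) by (auto simp: permutation_permutes)
  have orbit_E: "orbit \<sigma> s \<subseteq> E" if "s \<in> E" for s
  proof
    fix y assume "y \<in> orbit \<sigma> s"
    then show "y \<in> E" by induct (use that E(1) in auto)
  qed
  show ?thesis
  proof (cases "S \<inter> E = {}")
    case True
    then have eq: "\<And>x. x \<in> S \<Longrightarrow> \<sigma> x = \<tau> x" using E(3) by force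
    then have "cyclic_on \<tau> S" using S cyclic_cong by metis
    moreover have "c = {(x, \<tau> x) | x. x \<in> S}" using c eq by auto
    ultimately show ?thesis using in_all_cyclesI by blast
  next
    case False
    then obtain s where "s \<in> S" "s \<in> E" by auto
    then have SE: "S \<subseteq> E" using orbit_E S by (metis orbit_cyclic_eq3)
    have "\<tau> x = inv \<sigma> x" if x: "x \<in> S" for x
    proof -
      obtain y where y: "y \<in> E" "x = \<sigma> y" using x SE E(1) by blast
      then show ?thesis using E(2) assms(1) by (simp add: permutes_inverses(2))
    qed
    moreover have "cyclic_on (inv \<sigma>) S"
      using S orbit_inv_eq[OF perm] unfolding cyclic_on_def by simp
    ultimately have "cyclic_on \<tau> S" using cyclic_cong by metis
    moreover have "c = {(x, \<tau> x) | x. x \<in> S}\<inverse>"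
    proof -
      have surj: "\<exists>y\<in>S. x = \<sigma> y" if "x \<in> S" for x
      proof -
        have "\<sigma> ` S \<subseteq> S" using S by (auto intro: cyclic_on_inI)
        moreover have "inj_on \<sigma> S" using permutes_inj_on[OF assms(1)] .
        ultimately have "\<sigma> ` S = S" using endo_inj_surj[of S \<sigma>] by simp
        then show ?thesis using that by blast
      qed
      show ?thesis
        unfolding c
      proof safe
        fix x assume "x \<in> S"
        then show "\<exists>y. (\<sigma> x, x) = (y, \<tau> y) \<and> y \<in> S"
          using SE E(2) S by (metis cyclic_on_inI subsetD)
      next
        fix x assume "x \<in> S"
        then show "\<exists>y. (\<tau> x, x) = (y, \<sigma> y) \<and> y \<in> S"
          using SE E(2) surj by (metis subsetD)
      qed
    qed
    ultimately show ?thesis using in_all_cyclesI by blast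
  qed
qed

lemma reverses_on_imp_cyc_equiv:
  fixes \<sigma> \<tau> :: "'n::finite \<Rightarrow> 'n"
  assumes "\<sigma> permutes UNIV" "\<tau> permutes UNIV" "reverses_on E \<sigma> \<tau>"
  shows "cyc_equiv \<sigma> \<tau>"
  using reverses_on_all_cycles[OF assms(1,3)]
    reverses_on_all_cycles[OF assms(2) reverses_on_sym[OF assms(3)]]
  by (simp add: cyc_equiv_def)

text \<open>If the two differ at \<open>x\<close>, the cycle of \<open>\<sigma>\<close> through
  \<open>x\<close> is no cycle of \<open>\<tau>\<close>, hence the converse of one, so
  \<open>\<tau>\<close> undoes \<open>\<sigma>\<close> along the whole orbit.\<close>

lemma cyc_equiv_imp_reverses_on:
  fixes \<sigma> \<tau> :: "'n::finite \<Rightarrow> 'n"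
  assumes "\<sigma> permutes UNIV" "cyc_equiv \<sigma> \<tau>"
  shows "reverses_on {x. \<tau> x \<noteq> \<sigma> x} \<sigma> \<tau>"
proof -
  define E where "E = {x. \<tau> x \<noteq> \<sigma> x}"
  have rev: "\<tau> (\<sigma> x) = x \<and> \<sigma> x \<in> E" if x: "x \<in> E" for x
  proof -
    define c where "c = {(y, \<sigma> y) | y. y \<in> orbit \<sigma> x}"
    have perm: "permutation \<sigma>" using assms(1) by (auto simp: permutation_permutes)
    have x_in: "x \<in> orbit \<sigma> x" by (rule permutation_self_in_orbit[OF perm])
    have "c \<in> all_cycles \<sigma>"
      unfolding c_def by (rule in_all_cyclesI) (rule cyclic_on_orbit'[OF perm])
    then obtain d where d: "d \<in> all_cycles \<tau>" "c = d \<or> c = d\<inverse>"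
      using assms(2) by (auto simp: cyc_equiv_def)
    have d_graph: "v = \<tau> u" if "(u, v) \<in> d" for u v
      using d(1) that by (auto simp: all_cycles_def cycles_of_length_def)
    have "c \<noteq> d" using d_graph x x_in by (force simp: c_def E_def)
    with d(2) have cd: "c = d\<inverse>" by simp
    have undo: "\<tau> (\<sigma> y) = y" if "y \<in> orbit \<sigma> x" for y
    proof -
      have "(y, \<sigma> y) \<in> c" using that by (auto simp: c_def)
      then have "(\<sigma> y, y) \<in> d" using cd by simp
      then show ?thesis using d_graph by metis
    qed
    \<comment> \<open>Agreement at \<open>\<sigma> x\<close> would force
      \<open>\<sigma> (\<sigma> x) = x\<close>; the cycle would be its own inverse, and
      \<open>\<tau> x = \<sigma> x\<close>.\<close>
    have "\<tau> (\<sigma> x) \<noteq> \<sigma> (\<sigma> x)"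
    proof
      assume "\<tau> (\<sigma> x) = \<sigma> (\<sigma> x)"
      then have "\<sigma> (\<sigma> x) = x" using undo x_in by simp
      moreover have "\<tau> (\<sigma> (\<sigma> x)) = \<sigma> x" by (rule undo) (rule orbit.base)
      ultimately show False using x by (simp add: E_def)
    qed
    then show ?thesis using undo x_in by (simp add: E_def)
  qed
  have "\<sigma> ` E \<subseteq> E" using rev by blast
  moreover have "inj_on \<sigma> E" using permutes_inj_on[OF assms(1)] .
  ultimately have "\<sigma> ` E = E" using endo_inj_surj[of E \<sigma>] by simp
  then show ?thesis using rev unfolding reverses_on_def E_def by auto
qed

text \<open>A point moved by \<open>\<tau>\<close> lies on a cycle of length at least 2, whose pairs
  all belong to the graph of \<open>\<sigma>\<close>. Together with \<open>cyc_leI\<close> this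
  reduces the order to agreement at moved points.\<close>

lemma cyc_le_imp_eq:
  fixes \<sigma> \<tau> :: "'n::finite \<Rightarrow> 'n"
  assumes "\<tau> permutes UNIV" "cyc_le \<tau> \<sigma>" "\<tau> x \<noteq> x"
  shows "\<sigma> x = \<tau> x"
proof -
  have perm: "permutation \<tau>" using assms(1) by (auto simp: permutation_permutes)
  have cyc: "cyclic_on \<tau> (orbit \<tau> x)" by (rule cyclic_on_orbit'[OF perm])
  have x_in: "x \<in> orbit \<tau> x" by (rule permutation_self_in_orbit[OF perm])
  have "{x, \<tau> x} \<subseteq> orbit \<tau> x" using x_in by (auto intro: orbit.base)
  then have "card {x, \<tau> x} \<le> card (orbit \<tau> x)" by (intro card_mono) auto
  then have "card (orbit \<tau> x) \<ge> 2" using assms(3) by (simp add: card_insert_if)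
  then have "{(y, \<tau> y) | y. y \<in> orbit \<tau> x} \<in> cycles_of_length (card (orbit \<tau> x)) \<sigma>"
    using assms(2) cyc unfolding cyc_le_def cycles_of_length_def by blast
  then obtain T where "{(y, \<tau> y) | y. y \<in> orbit \<tau> x} = {(y, \<sigma> y) | y. y \<in> T}"
    by (auto simp: cycles_of_length_def)
  then show ?thesis using x_in by blast
qed

text \<open>A cycle of length at least 2 has no fixed points, so the agreement covers all of
  it.\<close>

lemma cyc_leI:
  assumes "\<And>x. \<tau> x \<noteq> x \<Longrightarrow> \<sigma> x = \<tau> x"
  shows "cyc_le \<tau> \<sigma>"
proof -
  have "{(x, \<tau> x) | x. x \<in> S} \<in> cycles_of_length (card S) \<sigma>"
    if S: "cyclic_on \<tau> S" "card S \<ge> 2" for S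
  proof -
    have eq: "\<tau> x = \<sigma> x" if "x \<in> S" for x
    proof -
      have "\<tau> x \<noteq> x" using eq_on_cyclic_on_iff1[OF S(1) that] S(2) by auto
      then show ?thesis using assms by metis
    qed
    then have "cyclic_on \<sigma> S" using S(1) cyclic_cong by metis
    moreover have "{(x, \<tau> x) | x. x \<in> S} = {(x, \<sigma> x) | x. x \<in> S}" using eq by auto
    ultimately show ?thesis unfolding cycles_of_length_def by blast
  qed
  then show ?thesis by (fastforce simp: cyc_le_def cycles_of_length_def)
qed

section \<open>Entries of positive semidefinite matrices\<close>

lemma pos_semidef_cnj:
  assumes "pos_semidef X"
  shows "X $ i $ j = cnj (X $ j $ i)"
proof -
  have "X $ i $ j = adjoint_matrix X $ i $ j"
    using assms by (simp add: pos_semidef_def)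
  then show ?thesis by (simp add: adjoint_matrix_def map_matrix_def transpose_def)
qed

lemma pos_semidef_form_two_coords:
  fixes X :: "complex^'n^'n"
  assumes "pos_semidef X" "i \<noteq> j"
  shows "0 \<le> Re (cnj \<alpha> * (X $ i $ i * \<alpha> + X $ i $ j * \<beta>) + cnj \<beta> * (X $ j $ i * \<alpha> + X $ j $ j * \<beta>))"
proof -
  define z :: "complex^'n" where "z = (\<chi> k. if k = i then \<alpha> else if k = j then \<beta> else 0)"
  have two: "(\<Sum>k\<in>UNIV. f k) = f i + f j" if "\<And>k. k \<noteq> i \<Longrightarrow> k \<noteq> j \<Longrightarrow> f k = 0"
    for f :: "'n \<Rightarrow> complex"
  proof -
    have "(\<Sum>k\<in>UNIV. f k) = (\<Sum>k\<in>{i, j}. f k)"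
      by (rule sum.mono_neutral_right) (use that in auto)
    then show ?thesis using assms(2) by simp
  qed
  have "(X *v z) $ k = X $ k $ i * \<alpha> + X $ k $ j * \<beta>" for k
    unfolding matrix_vector_mult_def using assms(2) by (simp add: two z_def)
  then have "(\<Sum>k\<in>UNIV. cnj (z $ k) * (X *v z) $ k) =
    cnj \<alpha> * (X $ i $ i * \<alpha> + X $ i $ j * \<beta>) + cnj \<beta> * (X $ j $ i * \<alpha> + X $ j $ j * \<beta>)"
    using assms(2) by (subst two) (auto simp: z_def)
  moreover have "(\<Sum>k\<in>UNIV. cnj (z $ k) * (X *v z) $ k) \<in> \<real>\<^sub>\<ge>\<^sub>0"
    using assms(1) by (simp add: pos_semidef_def)
  ultimately show ?thesis by (simp add: complex_nonneg_Reals_iff)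
qed

lemma pos_semidef_diag:
  fixes X :: "complex^'n^'n"
  assumes "pos_semidef X"
  shows "0 \<le> Re (X $ i $ i)" "X $ i $ i = of_real (Re (X $ i $ i))"
proof -
  show real: "X $ i $ i = of_real (Re (X $ i $ i))"
    using pos_semidef_cnj[OF assms, of i i] by (simp add: complex_eq_iff)
  define z :: "complex^'n" where "z = (\<chi> k. if k = i then 1 else 0)"
  have "(X *v z) $ i = X $ i $ i"
    unfolding matrix_vector_mult_def by (simp add: z_def if_distrib cong: if_cong)
  then have "(\<Sum>k\<in>UNIV. cnj (z $ k) * (X *v z) $ k) = X $ i $ i"
    by (simp add: z_def if_distrib if_distribR cong: if_cong)
  moreover have "(\<Sum>k\<in>UNIV. cnj (z $ k) * (X *v z) $ k) \<in> \<real>\<^sub>\<ge>\<^sub>0"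
    using assms by (simp add: pos_semidef_def)
  ultimately show "0 \<le> Re (X $ i $ i)" by (simp add: complex_nonneg_Reals_iff)
qed

text \<open>On suitable vectors supported at \<open>i\<close> and \<open>j\<close> the form becomes
  a real quadratic in \<open>t\<close> that is never negative; the bound is its discriminant
  condition.\<close>

lemma pos_semidef_minor:
  fixes X :: "complex^'n^'n"
  assumes "pos_semidef X"
  shows "(cmod (X $ i $ j))\<^sup>2 \<le> cmod (X $ i $ i) * cmod (X $ j $ j)"
proof (cases "i = j \<or> X $ i $ j = 0")
  case True
  then show ?thesis by (auto simp: power2_eq_square)
next
  case False
  define c where "c = X $ i $ j"
  define a b where "a = Re (X $ i $ i)" and "b = Re (X $ j $ j)"
  have X: "X $ i $ i = of_real a" "X $ j $ j = of_real b" "X $ j $ i = cnj c"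
    using pos_semidef_diag(2)[OF assms] pos_semidef_cnj[OF assms, of j i]
    by (auto simp: a_def b_def c_def)
  have nonneg: "0 \<le> a" "0 \<le> b" using pos_semidef_diag(1)[OF assms] by (auto simp: a_def b_def)
  have c2: "(cmod c)\<^sup>2 > 0" using False by (simp add: c_def)
  \<comment> \<open>The coordinates \<open>- t * c\<close> and \<open>1\<close> absorb the phase of
    \<open>c\<close>: both cross terms become \<open>- t |c|^2\<close>.\<close>
  have quad: "0 \<le> t\<^sup>2 * (cmod c)\<^sup>2 * a - 2 * t * (cmod c)\<^sup>2 + b" for t :: real
  proof -
    have "0 \<le> Re (cnj (- of_real t * c) * (X $ i $ i * (- of_real t * c) + X $ i $ j * 1)
        + cnj 1 * (X $ j $ i * (- of_real t * c) + X $ j $ j * 1))"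
      using False by (intro pos_semidef_form_two_coords[OF assms]) auto
    also have "\<dots> = t\<^sup>2 * (cmod c)\<^sup>2 * a - 2 * t * (cmod c)\<^sup>2 + b"
      unfolding X c_def[symmetric] cmod_power2 by (simp add: power2_eq_square algebra_simps)
    finally show ?thesis .
  qed
  have "(cmod c)\<^sup>2 \<le> a * b"
  proof (cases "a = 0")
    case True
    \<comment> \<open>The quadratic is now linear in \<open>t\<close>. The chosen \<open>t\<close>,
      available since \<open>c\<close> is nonzero, makes it \<open>- b - 2\<close>, against
      \<open>0 \<le> b\<close>.\<close>
    have "0 \<le> b - 2 * (b + 1)"
      using quad[of "(b + 1) / (cmod c)\<^sup>2"] True c2 by simp
    then show ?thesis using nonneg by simp
  next
    case False
    then have a: "a > 0" using nonneg by simp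
    \<comment> \<open>The quadratic attains its minimum at \<open>1 / a\<close>.\<close>
    have "0 \<le> (cmod c)\<^sup>2 / a - 2 * ((cmod c)\<^sup>2 / a) + b"
      using quad[of "1 / a"] a by (simp add: power2_eq_square)
    then have "(cmod c)\<^sup>2 / a \<le> b" by simp
    then show ?thesis using a by (simp add: pos_divide_le_eq mult.commute)
  qed
  then show ?thesis using nonneg X by (simp add: c_def[symmetric])
qed

text \<open>For \<open>k\<close> in \<open>E\<close>, the factor of \<open>\<tau>\<close> at
  \<open>\<sigma> k\<close> is the entry at \<open>(\<sigma> k, k)\<close>, the conjugate of the
  factor of \<open>\<sigma>\<close> at \<open>k\<close>. Reindexing along \<open>\<sigma>\<close>
  matches the moduli.\<close>

lemma perm_prod_reverses_on:
  fixes X :: "complex^'n^'n"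
  assumes "pos_semidef X" "\<sigma> permutes UNIV" "reverses_on E \<sigma> \<tau>"
  shows "cmod (perm_prod X \<tau>) = cmod (perm_prod X \<sigma>)"
proof -
  have E: "\<sigma> ` E = E" "\<And>x. x \<in> E \<Longrightarrow> \<tau> (\<sigma> x) = x" "\<And>x. x \<notin> E \<Longrightarrow> \<tau> x = \<sigma> x"
    using assms(3) by (auto simp: reverses_on_def)
  have split: "cmod (perm_prod X \<rho>) =
      (\<Prod>k\<in>E. cmod (X $ k $ \<rho> k)) * (\<Prod>k\<in>-E. cmod (X $ k $ \<rho> k))" for \<rho>
    unfolding perm_prod_def prod_norm[symmetric]
    by (subst prod.union_disjoint[symmetric]) auto
  have "(\<Prod>k\<in>E. cmod (X $ k $ \<tau> k)) = (\<Prod>k\<in>\<sigma> ` E. cmod (X $ k $ \<tau> k))" using E(1) by simp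
  also have "\<dots> = (\<Prod>k\<in>E. cmod (X $ \<sigma> k $ \<tau> (\<sigma> k)))"
    using permutes_inj_on[OF assms(2)] by (simp add: prod.reindex)
  also have "\<dots> = (\<Prod>k\<in>E. cmod (X $ k $ \<sigma> k))"
  proof (rule prod.cong)
    fix k assume "k \<in> E"
    then show "cmod (X $ \<sigma> k $ \<tau> (\<sigma> k)) = cmod (X $ k $ \<sigma> k)"
      using E(2) pos_semidef_cnj[OF assms(1), of "\<sigma> k" k] by simp
  qed simp
  moreover have "(\<Prod>k\<in>-E. cmod (X $ k $ \<tau> k)) = (\<Prod>k\<in>-E. cmod (X $ k $ \<sigma> k))"
    using E(3) by (intro prod.cong) auto
  ultimately show ?thesis by (simp add: split)
qed

text \<open>Off the fixed points \<open>N\<close> of \<open>\<tau>\<close> the factors agree. On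
  \<open>N\<close>, which \<open>\<sigma>\<close> permutes, \<open>pos_semidef_minor\<close> bounds
  the squared product for \<open>\<sigma>\<close> by a product with each diagonal entry twice, the
  square of that for \<open>\<tau>\<close>.\<close>

lemma perm_prod_mono_cyc_le:
  fixes X :: "complex^'n^'n"
  assumes "pos_semidef X" "\<sigma> permutes UNIV" "\<tau> permutes UNIV" "cyc_le \<tau> \<sigma>"
  shows "cmod (perm_prod X \<sigma>) \<le> cmod (perm_prod X \<tau>)"
proof -
  define N where "N = {x. \<tau> x = x}"
  have eq: "\<sigma> x = \<tau> x" if "x \<notin> N" for x
    using cyc_le_imp_eq[OF assms(3,4)] that by (auto simp: N_def)
  \<comment> \<open>If \<open>\<sigma> x\<close> were outside \<open>N\<close>, its
    \<open>\<tau>\<close>-preimage \<open>y\<close> would be moved too, and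
    \<open>\<sigma> y = \<tau> y = \<sigma> x\<close> with \<open>y \<noteq> x\<close> breaks
    injectivity.\<close>
  have "\<sigma> x \<in> N" if x: "x \<in> N" for x
  proof (rule ccontr)
    assume "\<sigma> x \<notin> N"
    obtain y where y: "\<sigma> x = \<tau> y" using assms(3) by (metis permutes_surj surjD)
    with \<open>\<sigma> x \<notin> N\<close> have "y \<notin> N" by (auto simp: N_def)
    then have "\<sigma> y = \<sigma> x" using eq y by simp
    then have "y = x" using permutes_inj[OF assms(2)] by (auto dest: injD)
    with \<open>y \<notin> N\<close> x show False by simp
  qed
  then have "\<sigma> ` N \<subseteq> N" by auto
  then have \<sigma>N: "\<sigma> ` N = N"
    using endo_inj_surj[of N \<sigma>] permutes_inj_on[OF assms(2)] by auto
  have split: "cmod (perm_prod X \<rho>) =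
      (\<Prod>k\<in>N. cmod (X $ k $ \<rho> k)) * (\<Prod>k\<in>-N. cmod (X $ k $ \<rho> k))" for \<rho>
    unfolding perm_prod_def prod_norm[symmetric]
    by (subst prod.union_disjoint[symmetric]) auto
  have "(\<Prod>k\<in>N. cmod (X $ k $ \<sigma> k))\<^sup>2 = (\<Prod>k\<in>N. (cmod (X $ k $ \<sigma> k))\<^sup>2)"
    by (simp add: prod_power_distrib)
  also have "\<dots> \<le> (\<Prod>k\<in>N. cmod (X $ k $ k) * cmod (X $ \<sigma> k $ \<sigma> k))"
    by (intro prod_mono) (use pos_semidef_minor[OF assms(1)] in auto)
  also have "\<dots> = (\<Prod>k\<in>N. cmod (X $ k $ k)) * (\<Prod>k\<in>\<sigma> ` N. cmod (X $ k $ k))"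
    using permutes_inj_on[OF assms(2)] by (simp add: prod.distrib prod.reindex)
  also have "\<dots> = (\<Prod>k\<in>N. cmod (X $ k $ \<tau> k))\<^sup>2"
    unfolding \<sigma>N by (simp add: power2_eq_square N_def)
  finally have "(\<Prod>k\<in>N. cmod (X $ k $ \<sigma> k)) \<le> (\<Prod>k\<in>N. cmod (X $ k $ \<tau> k))"
    by (rule power2_le_imp_le) (simp add: prod_nonneg)
  moreover have "(\<Prod>k\<in>-N. cmod (X $ k $ \<tau> k)) = (\<Prod>k\<in>-N. cmod (X $ k $ \<sigma> k))"
    using eq by (intro prod.cong) auto
  ultimately show ?thesis by (simp add: split mult_right_mono prod_nonneg)
qed

section \<open>Gram matrices of planar vectors\<close>

definition planar_gram :: "('n \<Rightarrow> real) \<Rightarrow> ('n \<Rightarrow> real) \<Rightarrow> complex^'n^'n" where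
  "planar_gram u w = (\<chi> i j. of_real (u i * u j + w i * w j))"

text \<open>The form at \<open>z\<close> equals \<open>|U|^2 + |W|^2\<close>, where \<open>U\<close>
  and \<open>W\<close> are the coordinates of the combination of the vectors with coefficients
  \<open>z\<close>.\<close>

lemma pos_semidef_planar_gram: "pos_semidef (planar_gram u w :: complex^'n^'n)"
proof -
  let ?X = "planar_gram u w :: complex^'n^'n"
  have "(\<Sum>i\<in>UNIV. cnj (z $ i) * (?X *v z) $ i) \<in> \<real>\<^sub>\<ge>\<^sub>0" for z :: "complex^'n"
  proof -
    define U where "U = (\<Sum>j\<in>UNIV. of_real (u j) * z $ j)"
    define W where "W = (\<Sum>j\<in>UNIV. of_real (w j) * z $ j)"
    have "(?X *v z) $ i = of_real (u i) * U + of_real (w i) * W" for i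
      by (simp add: matrix_vector_mult_def planar_gram_def U_def W_def sum_distrib_left
          sum.distrib algebra_simps)
    then have "(\<Sum>i\<in>UNIV. cnj (z $ i) * (?X *v z) $ i) =
        (\<Sum>i\<in>UNIV. of_real (u i) * cnj (z $ i)) * U + (\<Sum>i\<in>UNIV. of_real (w i) * cnj (z $ i)) * W"
      by (simp add: sum_distrib_left sum.distrib algebra_simps)
    also have "\<dots> = cnj U * U + cnj W * W"
      by (simp add: U_def W_def)
    also have "\<dots> = of_real ((cmod U)\<^sup>2 + (cmod W)\<^sup>2)"
      by (simp add: complex_norm_square mult.commute del: of_real_power)
    finally show ?thesis by (simp add: nonneg_Reals_of_real_iff)
  qed
  moreover have "?X = adjoint_matrix ?X"
    by (simp add: vec_eq_iff adjoint_matrix_def map_matrix_def transpose_def planar_gram_def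
        mult.commute)
  ultimately show ?thesis by (simp add: pos_semidef_def)
qed

text \<open>Indices other than \<open>a\<close> and \<open>b\<close> share the vector
  \<open>(1, 0)\<close>, so entries among them are 1 and a permutation product sees only how the
  permutation passes through \<open>a\<close> and \<open>b\<close>.\<close>

definition edge_gram :: "real \<Rightarrow> 'n \<Rightarrow> 'n \<Rightarrow> complex^'n^'n" where
  "edge_gram p a b = planar_gram (\<lambda>i. if i = a \<or> i = b then p else 1)
     (\<lambda>i. if i = a then -1 else if i = b then 1 else 0)"

lemma pos_semidef_edge_gram: "pos_semidef (edge_gram p a b)"
  by (simp add: edge_gram_def pos_semidef_planar_gram)

lemma edge_gram_nth:
  assumes "a \<noteq> b"
  shows "edge_gram p a b $ i $ j = of_real (
    if i \<in> {a, b} \<and> j \<in> {a, b} then (if i = j then p\<^sup>2 + 1 else p\<^sup>2 - 1)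
    else if i \<in> {a, b} \<or> j \<in> {a, b} then p else 1)"
  using assms by (auto simp: edge_gram_def planar_gram_def power2_eq_square)

text \<open>For \<open>p = 1\<close> the zeros sit exactly at \<open>(x, \<tau> x)\<close> and
  \<open>(\<tau> x, x)\<close>. The product of \<open>\<tau>\<close> hits one, so that of
  \<open>\<sigma>\<close> must hit one too.\<close>

lemma edge_of_dominating:
  fixes \<sigma> \<tau> :: "'n::finite \<Rightarrow> 'n"
  assumes dom: "\<And>X :: complex^'n^'n. pos_semidef X \<Longrightarrow> cmod (perm_prod X \<sigma>) \<le> cmod (perm_prod X \<tau>)"
    and "\<tau> x \<noteq> x"
  shows "\<sigma> x = \<tau> x \<or> \<sigma> (\<tau> x) = x"
proof (rule ccontr)
  let ?X = "edge_gram 1 x (\<tau> x)"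
  assume neg: "\<not> (\<sigma> x = \<tau> x \<or> \<sigma> (\<tau> x) = x)"
  have "perm_prod ?X \<tau> = 0"
    unfolding perm_prod_def using assms(2)
    by (intro prod_zero bexI[of _ x]) (auto simp: edge_gram_nth)
  moreover have "perm_prod ?X \<sigma> \<noteq> 0"
    unfolding perm_prod_def using assms(2) neg by (subst prod_zero_iff) (auto simp: edge_gram_nth)
  ultimately show False using dom[OF pos_semidef_edge_gram, of 1 x "\<tau> x"] by simp
qed

text \<open>\<open>edge_of_dominating\<close> cannot tell the transposition from a longer cycle
  through the same edge. For \<open>p = 2\<close> the weights can: leaving and re-entering
  \<open>{a, b}\<close> contributes \<open>2 * 2\<close> in place of the second factor 3.\<close>

lemma transposition_of_dominating:
  fixes \<sigma> \<tau> :: "'n::finite \<Rightarrow> 'n"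
  assumes dom: "\<And>X :: complex^'n^'n. pos_semidef X \<Longrightarrow> cmod (perm_prod X \<sigma>) \<le> cmod (perm_prod X \<tau>)"
    and perm: "\<sigma> permutes UNIV" "\<tau> permutes UNIV"
    and ab: "a \<noteq> b" "\<tau> a = b" "\<tau> b = a" "\<sigma> a = b"
  shows "\<sigma> b = a"
proof (rule ccontr)
  let ?X = "edge_gram 2 a b"
  assume neg: "\<sigma> b \<noteq> a"
  have inj: "\<sigma> u = \<sigma> v \<longleftrightarrow> u = v" "\<tau> u = \<tau> v \<longleftrightarrow> u = v" for u v
    using perm[THEN permutes_inj] by (simp_all add: inj_eq)
  \<comment> \<open>\<open>d\<close> is the one index outside \<open>{a, b}\<close> whose factor
    under \<open>\<sigma>\<close> is not 1. The rows \<open>a\<close>, \<open>b\<close>,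
    \<open>d\<close> contribute 3, 2, 2.\<close>
  obtain d where d: "\<sigma> d = a" using perm(1) by (metis permutes_surj surjD)
  have d_ne: "d \<noteq> a" "d \<noteq> b" using d neg ab by auto
  have \<sigma>b: "\<sigma> b \<noteq> b" using inj(1) ab by metis
  have other: "\<sigma> k \<notin> {a, b}" if "k \<notin> {a, b, d}" for k
    using inj(1)[of k a] inj(1)[of k d] that ab d by auto
  have "perm_prod ?X \<sigma> = (\<Prod>k\<in>{a, b, d}. ?X $ k $ \<sigma> k)"
    unfolding perm_prod_def
    by (rule prod.mono_neutral_right) (use other in \<open>auto simp: edge_gram_nth[OF ab(1)]\<close>)
  also have "\<dots> = 12"
    using ab d d_ne neg \<sigma>b by (simp add: edge_gram_nth[OF ab(1)])
  finally have \<sigma>: "perm_prod ?X \<sigma> = 12" .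
  have "\<tau> k \<notin> {a, b}" if "k \<notin> {a, b}" for k
    using inj(2)[of k a] inj(2)[of k b] that ab by auto
  then have "perm_prod ?X \<tau> = (\<Prod>k\<in>{a, b}. ?X $ k $ \<tau> k)"
    unfolding perm_prod_def
    by (intro prod.mono_neutral_right) (auto simp: edge_gram_nth[OF ab(1)])
  also have "\<dots> = 9"
    using ab by (simp add: edge_gram_nth[OF ab(1)])
  finally have "perm_prod ?X \<tau> = 9" .
  with \<sigma> dom[OF pos_semidef_edge_gram, of 2 a b] show False by simp
qed

text \<open>Orientation propagates along a cycle. If \<open>\<sigma>\<close> follows the first edge
  without undoing it, reversing the next edge would give
  \<open>\<sigma> (\<tau> (\<tau> x)) = \<sigma> x\<close>, so \<open>\<tau>\<close> would swap
  \<open>x\<close> and \<open>\<tau> x\<close>, the case settled by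
  \<open>transposition_of_dominating\<close>.\<close>

lemma successor_of_dominating:
  fixes \<sigma> \<tau> :: "'n::finite \<Rightarrow> 'n"
  assumes dom: "\<And>X :: complex^'n^'n. pos_semidef X \<Longrightarrow> cmod (perm_prod X \<sigma>) \<le> cmod (perm_prod X \<tau>)"
    and perm: "\<sigma> permutes UNIV" "\<tau> permutes UNIV"
    and x: "\<tau> x \<noteq> x"
  shows "\<sigma> (\<tau> x) = x \<or> (\<sigma> x = \<tau> x \<and> \<sigma> (\<tau> x) = \<tau> (\<tau> x))"
proof (cases "\<sigma> (\<tau> x) = x")
  case False
  then have \<sigma>x: "\<sigma> x = \<tau> x" using edge_of_dominating[OF dom x] by simp
  have "\<tau> (\<tau> x) \<noteq> x"
    using transposition_of_dominating[OF dom perm, of x "\<tau> x"] x \<sigma>x False by auto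
  moreover have "\<tau> (\<tau> x) \<noteq> \<tau> x" using x perm(2) by (metis injD permutes_inj)
  then have "\<sigma> (\<tau> x) = \<tau> (\<tau> x) \<or> \<sigma> (\<tau> (\<tau> x)) = \<tau> x"
    using edge_of_dominating[OF dom, of "\<tau> x"] by simp
  ultimately show ?thesis using \<sigma>x perm(1) by (metis injD permutes_inj)
qed simp

section \<open>Domination and the order on classes\<close>

text \<open>The modulus is constant on classes, so it can be compared at the
  representatives.\<close>

lemma cyc_class_le_imp_perm_prod_le:
  fixes X :: "complex^'n^'n"
  assumes "\<sigma> permutes UNIV" "\<tau> permutes UNIV"
    and "cyc_class_le (cyc_class \<tau>) (cyc_class \<sigma>)" "pos_semidef X"
  shows "cmod (perm_prod X \<sigma>) \<le> cmod (perm_prod X \<tau>)"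
proof -
  obtain \<tau>' \<sigma>' where *: "\<tau>' permutes UNIV" "cyc_equiv \<tau> \<tau>'" "\<sigma>' permutes UNIV" "cyc_equiv \<sigma> \<sigma>'"
      "cyc_le \<tau>' \<sigma>'"
    using assms(3) by (auto simp: cyc_class_le_def cyc_class_def)
  have "cmod (perm_prod X \<sigma>) = cmod (perm_prod X \<sigma>')"
    using perm_prod_reverses_on[OF assms(4,1) cyc_equiv_imp_reverses_on[OF assms(1) *(4)]] by simp
  also have "\<dots> \<le> cmod (perm_prod X \<tau>')"
    by (rule perm_prod_mono_cyc_le[OF assms(4) *(3,1,5)])
  also have "\<dots> = cmod (perm_prod X \<tau>)"
    by (rule perm_prod_reverses_on[OF assms(4,2) cyc_equiv_imp_reverses_on[OF assms(2) *(2)]])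
  finally show ?thesis .
qed

text \<open>\<open>\<sigma>'\<close> is \<open>\<sigma>\<close> with the cycles that run against
  \<open>\<tau>\<close> inverted. It stays in the class of \<open>\<sigma>\<close> and agrees with
  \<open>\<tau>\<close> wherever \<open>\<tau>\<close> moves a point, so \<open>\<tau>\<close> and
  \<open>\<sigma>'\<close> serve as representatives.\<close>

lemma dominating_imp_cyc_class_le:
  fixes \<sigma> \<tau> :: "'n::finite \<Rightarrow> 'n"
  assumes dom: "\<And>X :: complex^'n^'n. pos_semidef X \<Longrightarrow> cmod (perm_prod X \<sigma>) \<le> cmod (perm_prod X \<tau>)"
    and perm: "\<sigma> permutes UNIV" "\<tau> permutes UNIV"
  shows "cyc_class_le (cyc_class \<tau>) (cyc_class \<sigma>)"
proof -
  define E where "E = {x. \<tau> x \<noteq> x \<and> \<sigma> x \<noteq> \<tau> x}"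
  define \<sigma>' where "\<sigma>' = (\<lambda>x. if x \<in> E then \<tau> x else \<sigma> x)"
  have succ: "\<sigma> (\<tau> x) = x \<or> (\<sigma> x = \<tau> x \<and> \<sigma> (\<tau> x) = \<tau> (\<tau> x))" if "\<tau> x \<noteq> x" for x
    by (rule successor_of_dominating[OF dom perm that])
  have undo: "\<sigma> (\<tau> x) = x" if "x \<in> E" for x
    using succ that by (auto simp: E_def)
  \<comment> \<open>If \<open>\<sigma>\<close> followed \<open>\<tau>\<close> at
    \<open>\<tau> x\<close>, then \<open>undo\<close> would give
    \<open>\<tau> (\<tau> x) = x\<close>, and either alternative of \<open>succ\<close> at
    \<open>\<tau> x\<close> would read \<open>\<sigma> x = \<tau> x\<close>.\<close>
  have "\<tau> x \<in> E" if x: "x \<in> E" for x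
  proof -
    have ne: "\<tau> (\<tau> x) \<noteq> \<tau> x" using x permutes_inj[OF perm(2)] by (simp add: E_def inj_eq)
    moreover have "\<sigma> (\<tau> x) \<noteq> \<tau> (\<tau> x)"
      using succ[OF ne] undo[OF x] x by (auto simp: E_def)
    ultimately show ?thesis by (simp add: E_def)
  qed
  then have "\<tau> ` E \<subseteq> E" by blast
  then have \<tau>E: "\<tau> ` E = E"
    using endo_inj_surj[of E \<tau>] permutes_inj_on[OF perm(2)] by auto
  \<comment> \<open>This direction is immediate because \<open>\<sigma>'\<close> is
    \<open>\<tau>\<close> on \<open>E\<close>; symmetry supplies the other one and the invariance of
    \<open>E\<close> under \<open>\<sigma>\<close>.\<close>
  have "reverses_on E \<sigma>' \<sigma>"
    using \<tau>E undo by (auto simp: reverses_on_def \<sigma>'_def)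
  then have rev: "reverses_on E \<sigma> \<sigma>'" by (rule reverses_on_sym)
  then have \<sigma>E: "\<sigma> ` E = E" by (simp add: reverses_on_def)
  have "inj \<sigma>'"
  proof (rule injI)
    fix x y assume eq: "\<sigma>' x = \<sigma>' y"
    \<comment> \<open>Equal values under \<open>\<sigma>'\<close> thus come from the same branch,
      where \<open>\<tau>\<close> or \<open>\<sigma>\<close> is injective.\<close>
    have "\<sigma>' z \<in> E \<longleftrightarrow> z \<in> E" for z
      using \<tau>E inj_image_mem_iff[OF permutes_inj[OF perm(1)], of z E] \<sigma>E
      by (auto simp: \<sigma>'_def)
    with eq have "x \<in> E \<longleftrightarrow> y \<in> E" by metis
    with eq show "x = y"
      using perm[THEN permutes_inj] by (auto simp: \<sigma>'_def inj_eq split: if_splits)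
  qed
  then have \<sigma>': "\<sigma>' permutes UNIV"
    by (intro bij_imp_permutes) (auto simp: bij_def finite_UNIV_inj_surj)
  have "cyc_le \<tau> \<sigma>'" by (rule cyc_leI) (auto simp: \<sigma>'_def E_def)
  moreover have "cyc_equiv \<sigma> \<sigma>'"
    by (rule reverses_on_imp_cyc_equiv[OF perm(1) \<sigma>' rev])
  moreover have "cyc_equiv \<tau> \<tau>" by (auto simp: cyc_equiv_def)
  ultimately show ?thesis
    using perm(2) \<sigma>' by (auto simp: cyc_class_le_def cyc_class_def)
qed

text \<open>Equality gives domination in both directions, which also controls
  \<open>\<sigma>\<close> at the fixed points of \<open>\<tau>\<close>. The reversal argument then
  covers every point of disagreement.\<close>

lemma mutually_dominating_imp_cyc_equiv:
  fixes \<sigma> \<tau> :: "'n::finite \<Rightarrow> 'n"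
  assumes eq: "\<And>X :: complex^'n^'n. pos_semidef X \<Longrightarrow> cmod (perm_prod X \<sigma>) = cmod (perm_prod X \<tau>)"
    and perm: "\<sigma> permutes UNIV" "\<tau> permutes UNIV"
  shows "cyc_equiv \<tau> \<sigma>"
proof -
  define E where "E = {x. \<tau> x \<noteq> \<sigma> x}"
  have succ: "\<sigma> (\<tau> x) = x \<or> (\<sigma> x = \<tau> x \<and> \<sigma> (\<tau> x) = \<tau> (\<tau> x))" if "\<tau> x \<noteq> x" for x
    by (rule successor_of_dominating[OF _ perm that]) (simp add: eq)
  have succ': "\<tau> (\<sigma> x) = x \<or> (\<tau> x = \<sigma> x \<and> \<tau> (\<sigma> x) = \<sigma> (\<sigma> x))" if "\<sigma> x \<noteq> x" for x
    by (rule successor_of_dominating[OF _ perm(2,1) that]) (simp add: eq)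
  have inj: "\<tau> u = \<tau> v \<longleftrightarrow> u = v" for u v
    using permutes_inj[OF perm(2)] by (simp add: inj_eq)
  \<comment> \<open>Here the reverse domination enters. If \<open>\<tau>\<close> fixed
    \<open>x\<close>, then \<open>\<sigma>\<close> would move it, and both alternatives of
    \<open>succ'\<close> fail: the first by injectivity of \<open>\<tau>\<close>, the second by the
    choice of \<open>E\<close>.\<close>
  have moved: "\<tau> x \<noteq> x" if "x \<in> E" for x
    using that succ'[of x] inj by (metis (mono_tags) E_def mem_Collect_eq)
  have undo: "\<sigma> (\<tau> x) = x" if "x \<in> E" for x
    using succ[OF moved[OF that]] that by (auto simp: E_def)
  have "\<tau> x \<in> E" if x: "x \<in> E" for x
  proof -
    have ne: "\<tau> (\<tau> x) \<noteq> \<tau> x" using moved[OF x] inj by simp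
    have "\<sigma> (\<tau> x) \<noteq> \<tau> (\<tau> x)"
      using succ[OF ne] undo[OF x] x by (auto simp: E_def)
    then show ?thesis by (simp add: E_def)
  qed
  then have "\<tau> ` E \<subseteq> E" by blast
  then have "\<tau> ` E = E"
    using endo_inj_surj[of E \<tau>] permutes_inj_on[OF perm(2)] by auto
  then have "reverses_on E \<tau> \<sigma>"
    using undo by (auto simp: reverses_on_def E_def)
  then show ?thesis by (rule reverses_on_imp_cyc_equiv[OF perm(2,1)])
qed

theorem theorem4p11:
  fixes \<sigma> \<tau> :: "'n::finite \<Rightarrow> 'n"
  assumes "\<sigma> permutes UNIV" and "\<tau> permutes UNIV"
  shows "((\<forall>X :: complex^'n^'n. pos_semidef X \<longrightarrow> cmod (perm_prod X \<sigma>) \<le> cmod (perm_prod X \<tau>))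
            \<longleftrightarrow> cyc_class_le (cyc_class \<tau>) (cyc_class \<sigma>))
       \<and> ((\<forall>X :: complex^'n^'n. pos_semidef X \<longrightarrow> cmod (perm_prod X \<sigma>) = cmod (perm_prod X \<tau>))
            \<longleftrightarrow> cyc_equiv \<tau> \<sigma>)"
  using cyc_class_le_imp_perm_prod_le[OF assms] dominating_imp_cyc_class_le[OF _ assms]
    mutually_dominating_imp_cyc_equiv[OF _ assms]
    perm_prod_reverses_on[OF _ assms(2) cyc_equiv_imp_reverses_on[OF assms(2)]]
  by blast

end
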